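(* For all $x\in(0,\infty)$, $$\ln\Bigl(x+\frac12\Bigr)-\frac1x<\psi(x)<\ln\bigl(x+e^{-\gamma}\bigr)-\frac1x .$$ Moreover, the constants $\frac12$ and $e^{-\gamma}$ are the best possible: $\frac12$ cannot be replaced by any larger constant in the left-hand inequality, and $e^{-\gamma}$ cannot be replaced by any smaller constant in the right-hand inequality, if the inequality is to hold for all $x\in(0,\infty)$.
   Context: $\Gamma(x)=\int_0^\infty e^{-t}t^{x-1}\,dt$ for $x>0$ is Euler's gamma function, and $\psi(x)=\frac{d}{dx}\ln\Gamma(x)=\Gamma'(x)/\Gamma(x)$ for $x>0$ is the psi (digamma) function. $\gamma=0.577\ldots$ is the Euler–Mascheroni constant, so $e^{-\gamma}=0.56\ldots$. *)

theory Defs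
  imports "HOL-Analysis.Analysis"
begin

(* The library introduces Digamma by a series and Gamma by a limit; for positive reals these two
   facts identify Digamma with the logarithmic derivative of Euler's integral. *)

lemma Gamma_real_eq_integral:
  fixes x :: real
  assumes "x > 0"
  shows "((\<lambda>t. t powr (x - 1) / exp t) has_integral Gamma x) {0..}"
  using Gamma_integral_real[OF assms] .

lemma Digamma_eq_deriv_ln_Gamma:
  fixes x :: real
  assumes "x > 0"
  shows "((\<lambda>t. ln (Gamma t)) has_real_derivative Digamma x) (at x)"
    and "Digamma x = deriv Gamma x / Gamma x"
proof -
  have G: "(Gamma has_real_derivative Gamma x * Digamma x) (at x)"
    using assms by (intro has_field_derivative_Gamma) (auto simp: nonpos_Ints_def)
  have pos: "Gamma x > 0"
    using assms by (rule Gamma_real_pos)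
  show "((\<lambda>t. ln (Gamma t)) has_real_derivative Digamma x) (at x)"
    using DERIV_chain2[OF DERIV_ln[OF pos] G] pos by (simp add: mult.assoc [symmetric] less_imp_neq [symmetric])
  show "Digamma x = deriv Gamma x / Gamma x"
    using DERIV_imp_deriv[OF G] pos by (simp add: mult.assoc [symmetric] less_imp_neq [symmetric])
qed

end

theory Submission
  imports Defs "HOL-Real_Asymp.Real_Asymp"
begin

text \<open>
  Write \<open>\<psi>\<close> for the digamma function. Since \<open>\<psi> (x + 1) = \<psi> x + 1 / x\<close>, an inequality between
  \<open>\<psi> x\<close> and \<open>ln (x + b) - 1 / x\<close> is the same inequality between \<open>exp (\<psi> (x + 1)) - x\<close> and \<open>b\<close>
  (\<open>Digamma_compare_ln_shift_iff\<close>). So the bounds hold for all \<open>x > 0\<close>, with the best constants,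
  because the function \<open>exp (\<psi> (x + 1)) - x\<close> decreases strictly from \<open>exp (- \<gamma>)\<close>
  at \<open>x = 0\<close> (where \<open>\<psi> 1 = - \<gamma>\<close>) to its limit \<open>1 / 2\<close> at infinity.

  The monotonicity is \<open>exp_Digamma_minus_id_strict_antimono\<close>, for \<open>G y = exp (\<psi> y) - y\<close>. It comes
  from convexity: \<open>G'' = (\<psi>'' + \<psi>'\<^sup>2) exp \<psi>\<close> is positive
  (\<open>Tetragamma_plus_Trigamma_squared_pos\<close>), and a strictly convex function that is bounded above on
  a half-line unbounded to the right has a negative derivative. The limit at infinity comes from
  the classical bounds \<open>ln (y - 1 / 2) \<le> \<psi> y \<le> ln y - 1 / (2 y)\<close>, the second of which also
  bounds \<open>G\<close> above.

  These two bounds and the positivity of \<open>\<psi>'' + \<psi>'\<^sup>2\<close> are obtained in the same way. If \<open>f\<close> tends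
  to 0 along \<open>x, x + 1, x + 2, \<dots>\<close> and \<open>f y - f (y + 1)\<close> has a constant sign, then \<open>f x\<close> has this
  sign. The recurrences of the polygamma functions make the difference elementary for the two
  bounds, and for \<open>\<psi>'' + \<psi>'\<^sup>2\<close> they reduce its sign to a lower bound for \<open>\<psi>'\<close>
  (\<open>Trigamma_gt\<close>), which a second use of the same argument proves.
\<close>

section \<open>Positivity from differences\<close>

lemma nonneg_if_shift_nonincreasing_null:
  fixes f :: "real \<Rightarrow> real"
  assumes "\<And>y. y > c \<Longrightarrow> f (y + 1) \<le> f y"
    and "(\<lambda>n. f (x + real n)) \<longlonglongrightarrow> 0" and "x > c"
  shows "f x \<ge> 0"
proof -
  have "f (x + real (Suc n)) \<le> f (x + real n)" for n
    using assms(1)[of "x + real n"] assms(3) by (simp add: add_ac)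
  then have "decseq (\<lambda>n. f (x + real n))"
    by (intro decseq_SucI)
  then show ?thesis
    using decseq_ge[OF _ assms(2), of 0] by simp
qed

lemma pos_if_shift_decreasing_null:
  fixes f :: "real \<Rightarrow> real"
  assumes decr: "\<And>y. y > c \<Longrightarrow> f (y + 1) < f y"
    and lim: "(\<lambda>n. f (x + real n)) \<longlonglongrightarrow> 0" and "x > c"
  shows "f x > 0"
proof -
  have "(\<lambda>n. f (x + 1 + real n)) \<longlonglongrightarrow> 0"
    using LIMSEQ_Suc[OF lim] by (simp add: add_ac)
  then have "0 \<le> f (x + 1)"
    using decr \<open>x > c\<close>
    by (intro nonneg_if_shift_nonincreasing_null[of c]) (auto intro: less_imp_le)
  also have "\<dots> < f x"
    using decr \<open>x > c\<close> by simp
  finally show ?thesis .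
qed

section \<open>Polygamma functions along arithmetic progressions\<close>

lemma pos_not_nonpos_Int: "x > 0 \<Longrightarrow> (x::real) \<notin> \<int>\<^sub>\<le>\<^sub>0"
  by (auto elim!: nonpos_Ints_cases)

text \<open>
  Shifting the argument by \<open>m\<close> removes the first \<open>m\<close> terms of the series that represents
  the polygamma function, and the tails of a convergent series tend to 0.
\<close>

lemma Polygamma_shift_tendsto_0:
  fixes x :: real
  assumes "x > 0" "n > 0"
  shows "(\<lambda>m. Polygamma n (x + real m)) \<longlonglongrightarrow> 0"
proof -
  have "(\<lambda>m. \<Sum>k<m. inverse ((x + of_nat k) ^ Suc n)) \<longlonglongrightarrow> (-1) ^ Suc n * Polygamma n x / fact n"
    using Polygamma_LIMSEQ[of x n] assms pos_not_nonpos_Int[of x] unfolding sums_def by simp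
  then have "(\<lambda>m. Polygamma n x + (-1) ^ n * fact n * (\<Sum>k<m. inverse ((x + of_nat k) ^ Suc n)))
      \<longlonglongrightarrow> Polygamma n x + (-1) ^ n * fact n * ((-1) ^ Suc n * Polygamma n x / fact n)"
    by (intro tendsto_intros)
  moreover have "Polygamma n x + (-1) ^ n * fact n * ((-1) ^ Suc n * Polygamma n x / fact n) = 0"
    by (simp add: field_simps flip: power_mult_distrib)
  ultimately show ?thesis
    using assms pos_not_nonpos_Int[of x]
    by (subst Polygamma_plus_of_nat) (auto simp: inverse_eq_divide add_eq_0_iff)
qed

lemma Digamma_shift_minus_ln_tendsto_0:
  fixes x :: real
  assumes "x > 0"
  shows "(\<lambda>m. Digamma (x + real m) - ln (real m)) \<longlonglongrightarrow> 0"
proof -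
  have "(\<lambda>m. ln (real m) - (\<Sum>n<m. inverse (x + of_nat n))) \<longlonglongrightarrow> Digamma x"
    using Digamma_LIMSEQ[of x] assms by simp
  then have "(\<lambda>m. Digamma x - (ln (real m) - (\<Sum>n<m. inverse (x + of_nat n)))) \<longlonglongrightarrow> Digamma x - Digamma x"
    by (intro tendsto_intros)
  then show ?thesis
    using assms
    by (subst Polygamma_plus_of_nat) (auto simp: inverse_eq_divide add_eq_0_iff algebra_simps)
qed

section \<open>Inequalities for the derivatives of the digamma function\<close>

text \<open>
  The left-hand side minus the right-hand side falls by \<open>(1 / y - 1 / (y + 1))\<^sup>2 / 2\<close> from \<open>y\<close> to \<open>y + 1\<close>.
\<close>

lemma Trigamma_gt:
  fixes x :: real
  assumes "x > 0"
  shows "Polygamma 1 x > 1 / x + 1 / (2 * x\<^sup>2)"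
proof -
  have "Polygamma 1 x - 1 / x - 1 / (2 * x\<^sup>2) > 0"
  proof (rule pos_if_shift_decreasing_null[OF _ _ assms])
    fix y :: real assume y: "y > 0"
    have *: "Polygamma 1 (y + 1) = Polygamma 1 y - 1 / y\<^sup>2"
      using Polygamma_plus1[of y 1] y by (simp add: power2_eq_square)
    (* The recurrence contributes p\<^sup>2; it completes the square because p - q = p * q. *)
    define p q where "p = 1 / y" and "q = 1 / (y + 1)"
    have pq: "p - q = p * q" "p * q > 0"
      using y by (simp_all add: p_def q_def field_simps add_pos_pos)
    have "p\<^sup>2 - (p - q) - p\<^sup>2 / 2 + q\<^sup>2 / 2 = (p - q)\<^sup>2 / 2"
      unfolding pq(1) using pq(1) by algebra
    moreover have "(p - q)\<^sup>2 > 0"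
      unfolding pq(1) using pq(2) by (rule zero_less_power)
    moreover have "1 / y\<^sup>2 = p\<^sup>2" "1 / (2 * y\<^sup>2) = p\<^sup>2 / 2" "1 / (2 * (y + 1)\<^sup>2) = q\<^sup>2 / 2"
      by (simp_all add: p_def q_def power_divide)
    ultimately show "Polygamma 1 (y + 1) - 1 / (y + 1) - 1 / (2 * (y + 1)\<^sup>2)
        < Polygamma 1 y - 1 / y - 1 / (2 * y\<^sup>2)"
      unfolding * p_def q_def by linarith
  next
    have "(\<lambda>n. Polygamma 1 (x + real n) - 1 / (x + real n) - 1 / (2 * (x + real n)\<^sup>2)) \<longlonglongrightarrow> 0 - 0 - 0"
      by (intro tendsto_diff Polygamma_shift_tendsto_0 assms) (simp, real_asymp+)
    then show "(\<lambda>n. Polygamma 1 (x + real n) - 1 / (x + real n) - 1 / (2 * (x + real n)\<^sup>2)) \<longlonglongrightarrow> 0"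
      by simp
  qed
  then show ?thesis by linarith
qed

text \<open>
  This is what makes \<open>exp \<circ> Digamma\<close> strictly convex. From \<open>y\<close> to \<open>y + 1\<close> the left-hand side falls by
  \<open>2 / y\<^sup>2\<close> times the excess of the trigamma function over the bound of the preceding lemma.
\<close>

lemma Tetragamma_plus_Trigamma_squared_pos:
  fixes x :: real
  assumes "x > 0"
  shows "Polygamma 2 x + (Polygamma 1 x)\<^sup>2 > 0"
proof (rule pos_if_shift_decreasing_null[OF _ _ assms])
  fix y :: real assume y: "y > 0"
  have 1: "Polygamma 1 (y + 1) = Polygamma 1 y - 1 / y\<^sup>2"
    using Polygamma_plus1[of y 1] y by (simp add: power2_eq_square)
  have 2: "Polygamma 2 (y + 1) = Polygamma 2 y + 2 / y ^ 3"
    using Polygamma_plus1[of y 2] y by (simp add: power2_eq_square power3_eq_cube)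
  have "Polygamma 2 y + (Polygamma 1 y)\<^sup>2 - (Polygamma 2 (y + 1) + (Polygamma 1 (y + 1))\<^sup>2)
      = 2 / y\<^sup>2 * (Polygamma 1 y - (1 / y + 1 / (2 * y\<^sup>2)))"
    unfolding 1 2 using y by (simp add: field_simps power2_eq_square power3_eq_cube)
  also have "\<dots> > 0"
    using Trigamma_gt[OF y] y by (intro mult_pos_pos) auto
  finally show "Polygamma 2 (y + 1) + (Polygamma 1 (y + 1))\<^sup>2 < Polygamma 2 y + (Polygamma 1 y)\<^sup>2"
    by simp
next
  have "(\<lambda>n. Polygamma 2 (x + real n) + (Polygamma 1 (x + real n))\<^sup>2) \<longlonglongrightarrow> 0 + 0\<^sup>2"
    by (intro tendsto_add tendsto_power Polygamma_shift_tendsto_0 assms) auto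
  then show "(\<lambda>n. Polygamma 2 (x + real n) + (Polygamma 1 (x + real n))\<^sup>2) \<longlonglongrightarrow> 0"
    by simp
qed

section \<open>Logarithmic bounds for the digamma function\<close>

text \<open>
  The step from \<open>z\<close> to \<open>z + 1\<close> is the midpoint rule: \<open>1 / z\<close> is at most the integral of \<open>1 / t\<close>
  over the interval of length 1 centred at \<open>z\<close>.
\<close>

lemma ln_minus_half_le_Digamma:
  fixes y :: real
  assumes "y > 1 / 2"
  shows "ln (y - 1 / 2) \<le> Digamma y"
proof -
  let ?u = "\<lambda>y. Digamma y - ln (y - 1 / 2)"
  have "?u y \<ge> 0"
  proof (rule nonneg_if_shift_nonincreasing_null[OF _ _ assms])
    fix z :: real assume z: "z > 1 / 2"
    have "1 / z \<le> ln (z + 1 - 1 / 2) - ln (z - 1 / 2)"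
      using ln_inverse_approx_ge[of "z - 1 / 2" "z + 1 - 1 / 2"] z by simp
    then show "?u (z + 1) \<le> ?u z"
      using Digamma_plus1[of z] z by simp
  next
    have "(\<lambda>n. (Digamma (y + real n) - ln (real n)) + (ln (real n) - ln (y + real n - 1 / 2))) \<longlonglongrightarrow> 0 + 0"
      using assms by (intro tendsto_add Digamma_shift_minus_ln_tendsto_0) (simp, real_asymp)
    then show "(\<lambda>n. ?u (y + real n)) \<longlonglongrightarrow> 0" by simp
  qed
  then show ?thesis by simp
qed

text \<open>
  The step from \<open>z\<close> to \<open>z + 1\<close> is the trapezoidal rule, which overestimates the integral of the
  convex function \<open>1 / t\<close>.
\<close>

lemma Digamma_le_ln_minus:
  fixes y :: real
  assumes "y > 0"
  shows "Digamma y \<le> ln y - 1 / (2 * y)"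
proof -
  let ?v = "\<lambda>y. ln y - 1 / (2 * y) - Digamma y"
  have "?v y \<ge> 0"
  proof (rule nonneg_if_shift_nonincreasing_null[OF _ _ assms])
    fix z :: real assume z: "z > 0"
    define p q where "p = 1 / z" and "q = 1 / (z + 1)"
    have le: "ln (z + 1) - ln z \<le> (p + q) / 2"
      using ln_inverse_approx_le[of z 1] z by (simp add: inverse_eq_divide p_def q_def)
    have shift: "Digamma (z + 1) = Digamma z + p"
      unfolding p_def using z by (intro Digamma_plus1) simp
    have halves: "1 / (2 * z) = p / 2" "1 / (2 * (z + 1)) = q / 2"
      by (simp_all add: p_def q_def)
    show "?v (z + 1) \<le> ?v z"
      unfolding shift halves using le by (simp add: field_simps)
  next
    have "(\<lambda>n. (ln (y + real n) - ln (real n) - 1 / (2 * (y + real n))) - (Digamma (y + real n) - ln (real n)))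
       \<longlonglongrightarrow> 0 - 0"
      using assms by (intro tendsto_diff[of _ 0] Digamma_shift_minus_ln_tendsto_0) (real_asymp, simp)
    then show "(\<lambda>n. ?v (y + real n)) \<longlonglongrightarrow> 0"
      by (simp add: algebra_simps)
  qed
  then show ?thesis by simp
qed

section \<open>Monotonicity of the exponential of the digamma function minus the identity\<close>

lemma exp_Digamma_has_derivative:
  fixes y :: real
  assumes "y > 0"
  shows "((\<lambda>y. exp (Digamma y) - y) has_real_derivative Polygamma 1 y * exp (Digamma y) - 1) (at y)"
  using assms by (auto intro!: derivative_eq_intros pos_not_nonpos_Int)

lemma exp_Digamma_deriv_strict_mono:
  fixes x y :: real
  assumes "0 < x" "x < y"
  shows "Polygamma 1 x * exp (Digamma x) < Polygamma 1 y * exp (Digamma y)"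
proof (rule DERIV_pos_imp_increasing[OF assms(2)])
  fix s assume "x \<le> s" "s \<le> y"
  with assms have s: "s > 0" by simp
  have "((\<lambda>s. Polygamma 1 s * exp (Digamma s)) has_real_derivative
      (Polygamma 2 s + (Polygamma 1 s)\<^sup>2) * exp (Digamma s)) (at s)"
    using s by (auto intro!: derivative_eq_intros pos_not_nonpos_Int
        simp: algebra_simps power2_eq_square numeral_2_eq_2)
  moreover have "(Polygamma 2 s + (Polygamma 1 s)\<^sup>2) * exp (Digamma s) > 0"
    using Tetragamma_plus_Trigamma_squared_pos[OF s] by simp
  ultimately show "\<exists>d. ((\<lambda>s. Polygamma 1 s * exp (Digamma s)) has_real_derivative d) (at s) \<and> d > 0"
    by blast
qed

text \<open>
  Otherwise the derivative of \<open>exp (Digamma y) - y\<close>, being strictly increasing, would exceed a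
  positive constant to the right of \<open>c + 1\<close>, and this function would grow at least linearly. But
  it stays negative.
\<close>

lemma exp_Digamma_deriv_less_1:
  fixes c :: real
  assumes "c > 0"
  shows "Polygamma 1 c * exp (Digamma c) < 1"
proof (rule ccontr)
  assume "\<not> ?thesis"
  define G where "G = (\<lambda>y::real. exp (Digamma y) - y)"
  define d where "d = Polygamma 1 (c + 1) * exp (Digamma (c + 1)) - 1"
  have d: "d > 0"
    using exp_Digamma_deriv_strict_mono[of c "c + 1"] assms \<open>\<not> _\<close> by (simp add: d_def)
  have G_neg: "G y < 0" if "y > 0" for y
  proof -
    have "Digamma y \<le> ln y - 1 / (2 * y)"
      by (rule Digamma_le_ln_minus[OF that])
    also have "\<dots> < ln y"
      using that by simp
    finally show ?thesis
      using that by (simp add: G_def) (metis exp_less_mono exp_ln)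
  qed
  (* A line of slope d through the point of the graph over c + 1 reaches 0 at y. *)
  define y where "y = c + 1 - G (c + 1) / d"
  have y: "y > c + 1"
    using G_neg[of "c + 1"] assms d by (simp add: y_def divide_neg_pos)
  obtain z where z: "z > c + 1" "z < y"
    and eq: "G y - G (c + 1) = (y - (c + 1)) * (Polygamma 1 z * exp (Digamma z) - 1)"
    using MVT2[OF y, of G "\<lambda>y. Polygamma 1 y * exp (Digamma y) - 1"] exp_Digamma_has_derivative assms
    unfolding G_def by force
  have "d < Polygamma 1 z * exp (Digamma z) - 1"
    using exp_Digamma_deriv_strict_mono[of "c + 1" z] assms z by (simp add: d_def)
  then have "(y - (c + 1)) * d < G y - G (c + 1)"
    unfolding eq using y by (intro mult_strict_left_mono) auto
  then have "G y > 0"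
    using d by (simp add: y_def)
  then show False
    using G_neg[of y] y assms by simp
qed

lemma exp_Digamma_minus_id_strict_antimono:
  fixes x y :: real
  assumes "0 < x" "x < y"
  shows "exp (Digamma y) - y < exp (Digamma x) - x"
proof (rule DERIV_neg_imp_decreasing[OF assms(2)])
  fix s assume "x \<le> s" "s \<le> y"
  with assms have "s > 0" by simp
  then show "\<exists>d. ((\<lambda>y. exp (Digamma y) - y) has_real_derivative d) (at s) \<and> d < 0"
    using exp_Digamma_has_derivative[of s] exp_Digamma_deriv_less_1[of s]
    by (intro exI[of _ "Polygamma 1 s * exp (Digamma s) - 1"]) auto
qed

section \<open>The sharp bounds\<close>

lemma Digamma_compare_ln_shift_iff:
  fixes x b :: real
  assumes "x > 0" "x + b > 0"
  shows "Digamma x < ln (x + b) - 1 / x \<longleftrightarrow> exp (Digamma (x + 1)) - x < b"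
    and "ln (x + b) - 1 / x < Digamma x \<longleftrightarrow> b < exp (Digamma (x + 1)) - x"
proof -
  have *: "Digamma (x + 1) = Digamma x + 1 / x"
    using assms by (intro Digamma_plus1) simp
  have "Digamma x < ln (x + b) - 1 / x \<longleftrightarrow> exp (Digamma (x + 1)) < exp (ln (x + b))"
    unfolding * by (subst exp_less_cancel_iff) argo
  then show "Digamma x < ln (x + b) - 1 / x \<longleftrightarrow> exp (Digamma (x + 1)) - x < b"
    using assms by auto
  have "ln (x + b) - 1 / x < Digamma x \<longleftrightarrow> exp (ln (x + b)) < exp (Digamma (x + 1))"
    unfolding * by (subst exp_less_cancel_iff) argo
  then show "ln (x + b) - 1 / x < Digamma x \<longleftrightarrow> b < exp (Digamma (x + 1)) - x"
    using assms by auto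
qed

text \<open>
  The logarithmic lower bound is not strict; strictness comes from applying it one step further to
  the right, where the decreasing function \<open>exp (Digamma y) - y\<close> has a strictly smaller value.
\<close>

lemma half_less_exp_Digamma_shift:
  fixes x :: real
  assumes "x > 0"
  shows "1 / 2 < exp (Digamma (x + 1)) - x"
proof -
  have "exp (ln (x + 2 - 1 / 2)) \<le> exp (Digamma (x + 2))"
    using ln_minus_half_le_Digamma[of "x + 2"] assms by (subst exp_le_cancel_iff) simp
  then have "- 1 / 2 \<le> exp (Digamma (x + 2)) - (x + 2)"
    using assms by simp
  also have "\<dots> < exp (Digamma (x + 1)) - (x + 1)"
    using assms by (intro exp_Digamma_minus_id_strict_antimono) auto
  finally show ?thesis by simp
qed

text \<open>
  By the upper bound for \<open>Digamma (x + 1)\<close> the left-hand side is at most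
  \<open>(x + 1) * exp (- 1 / (2 * (x + 1))) - x\<close>, whose limit at infinity is \<open>1 / 2\<close>.
\<close>

lemma ex_exp_Digamma_shift_less:
  fixes a :: real
  assumes "a > 1 / 2"
  shows "\<exists>x>0. exp (Digamma (x + 1)) - x < a"
proof -
  have "((\<lambda>x::real. (x + 1) * exp (- 1 / (2 * (x + 1))) - x) \<longlongrightarrow> 1 / 2) at_top"
    by real_asymp
  then have "eventually (\<lambda>x. (x + 1) * exp (- 1 / (2 * (x + 1))) - x < a) at_top"
    using assms by (rule order_tendstoD)
  with eventually_gt_at_top[of 0]
  have "eventually (\<lambda>x. x > 0 \<and> (x + 1) * exp (- 1 / (2 * (x + 1))) - x < a) at_top"
    by eventually_elim simp
  then obtain x where x: "x > 0" "(x + 1) * exp (- 1 / (2 * (x + 1))) - x < a"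
    using eventually_happens[of _ "at_top :: real filter"] by auto
  have "exp (Digamma (x + 1)) \<le> exp (ln (x + 1) - 1 / (2 * (x + 1)))"
    using Digamma_le_ln_minus[of "x + 1"] x by simp
  also have "\<dots> = (x + 1) * exp (- 1 / (2 * (x + 1)))"
    using x by (simp add: exp_diff exp_minus divide_inverse)
  finally show ?thesis
    using x by force
qed

lemma ex_exp_Digamma_shift_greater:
  fixes b :: real
  assumes "b < exp (- euler_mascheroni)"
  shows "\<exists>x>0. b < exp (Digamma (x + 1)) - x"
proof -
  have "((\<lambda>x::real. exp (Digamma (x + 1)) - x) \<longlongrightarrow> exp (Digamma (0 + 1)) - 0) (at_right 0)"
    by (intro tendsto_intros) (auto intro!: pos_not_nonpos_Int)
  then have "((\<lambda>x::real. exp (Digamma (x + 1)) - x) \<longlongrightarrow> exp (- euler_mascheroni)) (at_right 0)"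
    by simp
  then have "eventually (\<lambda>x. b < exp (Digamma (x + 1)) - x) (at_right 0)"
    using assms by (rule order_tendstoD)
  with eventually_at_right_less[of 0]
  have "eventually (\<lambda>x. x > 0 \<and> b < exp (Digamma (x + 1)) - x) (at_right 0)"
    by eventually_elim simp
  then show ?thesis
    using eventually_happens[of _ "at_right (0::real)"] by auto
qed

theorem theorem1:
  shows "(\<forall>x::real. x > 0 \<longrightarrow>
            ln (x + 1 / 2) - 1 / x < Digamma x \<and>
            Digamma x < ln (x + exp (- euler_mascheroni)) - 1 / x) \<and>
         (\<forall>a::real. a > 1 / 2 \<longrightarrow>
            \<not> (\<forall>x::real. x > 0 \<longrightarrow> ln (x + a) - 1 / x < Digamma x)) \<and>
         (\<forall>b::real. b < exp (- euler_mascheroni) \<longrightarrow>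
            \<not> (\<forall>x::real. x > 0 \<and> x + b > 0 \<longrightarrow> Digamma x < ln (x + b) - 1 / x))"
proof (intro conjI allI impI)
  fix x :: real assume x: "x > 0"
  show "ln (x + 1 / 2) - 1 / x < Digamma x"
    using half_less_exp_Digamma_shift[OF x] x by (subst Digamma_compare_ln_shift_iff) auto
  have "exp (Digamma (x + 1)) - x < exp (- euler_mascheroni)"
    using exp_Digamma_minus_id_strict_antimono[of 1 "x + 1"] x by simp
  then show "Digamma x < ln (x + exp (- euler_mascheroni)) - 1 / x"
    using x by (subst Digamma_compare_ln_shift_iff) (auto simp: add_pos_pos)
next
  fix a :: real assume a: "a > 1 / 2"
  then obtain x where x: "x > 0" "exp (Digamma (x + 1)) - x < a"
    using ex_exp_Digamma_shift_less by blast
  then have "Digamma x < ln (x + a) - 1 / x"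
    using a by (subst Digamma_compare_ln_shift_iff) auto
  then show "\<not> (\<forall>x>0. ln (x + a) - 1 / x < Digamma x)"
    using x by (auto simp: not_less intro!: exI[of _ x])
next
  fix b :: real assume b: "b < exp (- euler_mascheroni)"
  (* For b \<le> 1 / 2 the last inequality holds at every x > 0, so x only has to make x + b
     positive. For b > 1 / 2 positivity is automatic, and x has to be small. *)
  have "\<exists>x>0. x + b > 0 \<and> b < exp (Digamma (x + 1)) - x"
  proof (cases "b \<le> 1 / 2")
    case True
    then show ?thesis
      using half_less_exp_Digamma_shift[of "\<bar>b\<bar> + 1"] by (intro exI[of _ "\<bar>b\<bar> + 1"]) linarith
  next
    case False
    then show ?thesis
      using ex_exp_Digamma_shift_greater[OF b] by force
  qed
  then show "\<not> (\<forall>x. x > 0 \<and> x + b > 0 \<longrightarrow> Digamma x < ln (x + b) - 1 / x)"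
    using Digamma_compare_ln_shift_iff(2)[of _ b] by (metis less_asym)
qed

end
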